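(* Let $\mathscr{P}$ be the species of point-determining graphs, $\mathscr{Q}$ the species of co-point-determining graphs, $\mathscr{P}^c$ the species of connected point-determining graphs, and $\mathscr{Q}^c$ the species of connected co-point-determining graphs. Then $$\mathscr{P}=\mathscr{Q}=(1+X)\cdot(\mathscr{E}\circ\mathscr{P}^c_{\ge 2})=\mathscr{E}\circ\mathscr{Q}^c .$$
   Context: All graphs are finite and simple. A species $F$ is a functor from the category of finite sets with bijections to itself; $F[U]$ is the finite set of $F$-structures on $U$. Equality of species means isomorphism (natural isomorphism). For a species of graphs, $F[U]$ is a set of graphs with vertex set $U$, with transport by relabeling. Sum of species is disjoint union of structures; the product is $(\Phi\cdot\Psi)[U]=\bigsqcup_{U=U_1\sqcup U_2}\Phi[U_1]\times\Psi[U_2]$. For $\Psi[\varnothing]=\varnothing$, a $\Phi\circ\Psi$-structure on $U$ is a partition $\pi$ of $U$ into nonempty blocks, a $\Phi$-structure on the set of blocks, and a $\Psi$-structure on each block. $1$ is the species with exactly one structure on $\varnothing$ and none on other sets; $X$ is the species of singletons (one structure on each one-element set, none otherwise); $\mathscr{E}$ is the species of sets (exactly one structure on each finite set). $F_{\ge n}$ denotes the species of $F$-structures on sets of cardinality at least $n$. The neighborhood of a vertex is the set of vertices adjacent to it. A graph is point-determining if distinct vertices have distinct neighborhoods; co-point-determining if its complement is point-determining. The empty graph is regarded as point-determining and co-point-determining, but not as connected. *)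

theory Defs
  imports "Graph_Theory.Digraph_Component" "HOL-Library.Disjoint_Sets" "HOL-Library.FuncSet"
begin

section \<open>Species\<close>

text \<open>
  A species assigns to every finite set \<open>U\<close> of labels of type \<open>'a\<close> a finite set of structures
  of type \<open>'s\<close>. A bijection from \<open>U\<close> to \<open>V\<close> is given by a function \<open>\<sigma>\<close> with
  \<open>inj_on \<sigma> U\<close> and \<open>V = \<sigma> ` U\<close>; only its values on \<open>U\<close> matter (law \<open>transport_cong\<close>), and
  \<open>transport F U \<sigma>\<close> is the induced map from \<open>structs F U\<close> to \<open>structs F (\<sigma> ` U)\<close>.
  Nothing is required of infinite \<open>U\<close>.
\<close>

record ('a, 's) species =
  structs :: "'a set \<Rightarrow> 's set"
  transport :: "'a set \<Rightarrow> ('a \<Rightarrow> 'a) \<Rightarrow> 's \<Rightarrow> 's"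

locale is_species =
  fixes F :: "('a, 's) species"
  assumes finite_structs: "finite U \<Longrightarrow> finite (structs F U)"
    and transport_in_structs:
      "\<lbrakk>finite U; inj_on \<sigma> U; s \<in> structs F U\<rbrakk> \<Longrightarrow> transport F U \<sigma> s \<in> structs F (\<sigma> ` U)"
    and transport_cong:
      "\<lbrakk>finite U; inj_on \<sigma> U; \<And>x. x \<in> U \<Longrightarrow> \<sigma> x = \<tau> x; s \<in> structs F U\<rbrakk>
        \<Longrightarrow> transport F U \<sigma> s = transport F U \<tau> s"
    and transport_id:
      "\<lbrakk>finite U; s \<in> structs F U\<rbrakk> \<Longrightarrow> transport F U id s = s"
    and transport_comp:
      "\<lbrakk>finite U; inj_on \<sigma> U; inj_on \<tau> (\<sigma> ` U); s \<in> structs F U\<rbrakk>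
        \<Longrightarrow> transport F U (\<tau> \<circ> \<sigma>) s = transport F (\<sigma> ` U) \<tau> (transport F U \<sigma> s)"

definition species_iso :: "('a, 's) species \<Rightarrow> ('a, 't) species \<Rightarrow> bool" (infix \<open>\<cong>\<^sub>S\<close> 50) where
  "F \<cong>\<^sub>S G \<longleftrightarrow> is_species F \<and> is_species G \<and>
    (\<exists>\<eta>. (\<forall>U. finite U \<longrightarrow> bij_betw (\<eta> U) (structs F U) (structs G U)) \<and>
         (\<forall>U \<sigma>. \<forall>s\<in>structs F U. finite U \<and> inj_on \<sigma> U \<longrightarrow>
            \<eta> (\<sigma> ` U) (transport F U \<sigma> s) = transport G U \<sigma> (\<eta> U s)))"

subsection \<open>Operations\<close>

definition species_sum :: "('a, 's) species \<Rightarrow> ('a, 't) species \<Rightarrow> ('a, 's + 't) species"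
    (infixl \<open>+\<^sub>S\<close> 65) where
  "F +\<^sub>S G = \<lparr>structs = (\<lambda>U. structs F U <+> structs G U),
             transport = (\<lambda>U \<sigma>. map_sum (transport F U \<sigma>) (transport G U \<sigma>))\<rparr>"

definition species_prod ::
    "('a, 's) species \<Rightarrow> ('a, 't) species \<Rightarrow> ('a, 'a set \<times> 'a set \<times> 's \<times> 't) species"
    (infixl \<open>\<cdot>\<^sub>S\<close> 70) where
  "F \<cdot>\<^sub>S G =
    \<lparr>structs = (\<lambda>U. {(U\<^sub>1, U\<^sub>2, s, t). U\<^sub>1 \<union> U\<^sub>2 = U \<and> U\<^sub>1 \<inter> U\<^sub>2 = {} \<and>
                       s \<in> structs F U\<^sub>1 \<and> t \<in> structs G U\<^sub>2}),
     transport = (\<lambda>U \<sigma> (U\<^sub>1, U\<^sub>2, s, t).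
                   (\<sigma> ` U\<^sub>1, \<sigma> ` U\<^sub>2, transport F U\<^sub>1 \<sigma> s, transport G U\<^sub>2 \<sigma> t))\<rparr>"

text \<open>
  The outer species of a composition is labelled by blocks, hence has label type \<open>'a set\<close>.
  The family of inner structures is an extensional function on the set of blocks; its
  transport at a block \<open>C\<close> of the new partition comes from the block \<open>B\<close> with \<open>\<sigma> ` B = C\<close>.
  The definition is meant for \<open>structs G {} = {}\<close>.
\<close>

definition species_comp ::
    "('a set, 's) species \<Rightarrow> ('a, 't) species \<Rightarrow> ('a, 'a set set \<times> 's \<times> ('a set \<Rightarrow> 't)) species"
    (infixl \<open>\<circ>\<^sub>S\<close> 75) where
  "F \<circ>\<^sub>S G =
    \<lparr>structs = (\<lambda>U. {(\<pi>, s, g). partition_on U \<pi> \<and> s \<in> structs F \<pi> \<and>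
                       g \<in> (\<Pi>\<^sub>E B\<in>\<pi>. structs G B)}),
     transport = (\<lambda>U \<sigma> (\<pi>, s, g).
                   ((`) \<sigma> ` \<pi>, transport F \<pi> ((`) \<sigma>) s,
                    \<lambda>C\<in>(`) \<sigma> ` \<pi>. let B = inv_into \<pi> ((`) \<sigma>) C in transport G B \<sigma> (g B)))\<rparr>"

definition species_ge :: "nat \<Rightarrow> ('a, 's) species \<Rightarrow> ('a, 's) species" where
  "species_ge n F = F\<lparr>structs := (\<lambda>U. if card U \<ge> n then structs F U else {})\<rparr>"

subsection \<open>The species \<open>1\<close>, \<open>X\<close> and of sets\<close>

definition species_one :: "('a, unit) species" (\<open>1\<^sub>S\<close>) where
  "1\<^sub>S = \<lparr>structs = (\<lambda>U. if U = {} then {()} else {}), transport = (\<lambda>U \<sigma> s. s)\<rparr>"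

definition species_X :: "('a, unit) species" (\<open>X\<^sub>S\<close>) where
  "X\<^sub>S = \<lparr>structs = (\<lambda>U. if card U = 1 then {()} else {}), transport = (\<lambda>U \<sigma> s. s)\<rparr>"

definition species_sets :: "('a, unit) species" (\<open>E\<^sub>S\<close>) where
  "E\<^sub>S = \<lparr>structs = (\<lambda>U. {()}), transport = (\<lambda>U \<sigma> s. s)\<rparr>"

section \<open>Species of graphs\<close>

text \<open>
  Finite simple graphs are the \<open>pair_graph\<close>s of \<open>Graph_Theory\<close>: finite, loop-free digraphs
  whose arc relation is symmetric. The library's \<open>connected\<close> excludes the empty graph.
\<close>

definition neighborhood :: "'a pair_pre_digraph \<Rightarrow> 'a \<Rightarrow> 'a set" where
  "neighborhood G v = {w \<in> pverts G. (v, w) \<in> parcs G}"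

definition graph_complement :: "'a pair_pre_digraph \<Rightarrow> 'a pair_pre_digraph" where
  "graph_complement G = \<lparr>pverts = pverts G,
     parcs = {(u, v). u \<in> pverts G \<and> v \<in> pverts G \<and> u \<noteq> v \<and> (u, v) \<notin> parcs G}\<rparr>"

definition point_determining :: "'a pair_pre_digraph \<Rightarrow> bool" where
  "point_determining G \<longleftrightarrow>
    (\<forall>u\<in>pverts G. \<forall>v\<in>pverts G. u \<noteq> v \<longrightarrow> neighborhood G u \<noteq> neighborhood G v)"

definition co_point_determining :: "'a pair_pre_digraph \<Rightarrow> bool" where
  "co_point_determining G \<longleftrightarrow> point_determining (graph_complement G)"

definition relabel :: "('a \<Rightarrow> 'a) \<Rightarrow> 'a pair_pre_digraph \<Rightarrow> 'a pair_pre_digraph" where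
  "relabel \<sigma> G = \<lparr>pverts = \<sigma> ` pverts G, parcs = map_prod \<sigma> \<sigma> ` parcs G\<rparr>"

definition graph_species ::
    "('a pair_pre_digraph \<Rightarrow> bool) \<Rightarrow> ('a, 'a pair_pre_digraph) species" where
  "graph_species \<Phi> = \<lparr>structs = (\<lambda>U. {G. pair_graph G \<and> pverts G = U \<and> \<Phi> G}),
                      transport = (\<lambda>U \<sigma>. relabel \<sigma>)\<rparr>"

definition \<P> :: "('a, 'a pair_pre_digraph) species" where
  "\<P> = graph_species point_determining"

definition \<Q> :: "('a, 'a pair_pre_digraph) species" where
  "\<Q> = graph_species co_point_determining"

definition \<P>\<^sub>c :: "('a, 'a pair_pre_digraph) species" where
  "\<P>\<^sub>c = graph_species (\<lambda>G. connected (with_proj G) \<and> point_determining G)"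

definition \<Q>\<^sub>c :: "('a, 'a pair_pre_digraph) species" where
  "\<Q>\<^sub>c = graph_species (\<lambda>G. connected (with_proj G) \<and> co_point_determining G)"

end

theory Submission
  imports Defs
begin

text \<open>
  Complementation exchanges point-determining and co-point-determining graphs and commutes with
  relabelling, so it is the isomorphism of \<open>\<P>\<close> with \<open>\<Q>\<close>. The two other descriptions come
  from one principle (\<open>sets_of_connected_graphs\<close>): a class of graphs in which membership can be
  tested on each connected component separately is the composition of the species of sets with
  the species of its connected members.

  For \<open>\<Q>\<close> the principle applies directly. Two vertices have the same neighborhood in the
  complement exactly when they have the same closed neighborhood in the graph. A closed
  neighborhood is nonempty and lies in one component, so a coincidence can occur only inside a
  component (\<open>co_point_determining_components\<close>).

  For \<open>\<P>\<close> it does not, because all isolated vertices share the empty neighborhood although they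
  lie in different components. This is the only obstruction: a point-determining graph has at most
  one isolated vertex, and removing it leaves a point-determining graph without isolated vertices.
  That vertex, present or absent, is the factor \<open>1 + X\<close>
  (\<open>point_determining_split_isolated\<close>). Without isolated vertices all neighborhoods are nonempty,
  and being point-determining can be tested on components again, where having no isolated vertex
  means having at least two vertices (\<open>point_determining_no_isolated_components\<close>).

  In both applications the natural map goes from the composite structure to the graph: taking
  unions commutes with relabelling by mere calculation, whereas the components of a relabelled
  graph would have to be determined first.
\<close>

section \<open>Isomorphism of species\<close>

lemma species_isoI:
  assumes "is_species F" "is_species G"
    and "\<And>U. finite U \<Longrightarrow> bij_betw (\<eta> U) (structs F U) (structs G U)"
    and "\<And>U \<sigma> s. \<lbrakk>finite U; inj_on \<sigma> U; s \<in> structs F U\<rbrakk>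
      \<Longrightarrow> \<eta> (\<sigma> ` U) (transport F U \<sigma> s) = transport G U \<sigma> (\<eta> U s)"
  shows "F \<cong>\<^sub>S G"
  unfolding species_iso_def
  by (intro conjI exI[of _ \<eta>] allI impI ballI) (use assms in simp_all)

lemma species_isoE:
  assumes "F \<cong>\<^sub>S G"
  obtains \<eta> where "is_species F" "is_species G"
    and "\<And>U. finite U \<Longrightarrow> bij_betw (\<eta> U) (structs F U) (structs G U)"
    and "\<And>U \<sigma> s. \<lbrakk>finite U; inj_on \<sigma> U; s \<in> structs F U\<rbrakk>
      \<Longrightarrow> \<eta> (\<sigma> ` U) (transport F U \<sigma> s) = transport G U \<sigma> (\<eta> U s)"
proof -
  from assms[unfolded species_iso_def] obtain \<eta> where "is_species F" "is_species G"
    and "\<forall>U. finite U \<longrightarrow> bij_betw (\<eta> U) (structs F U) (structs G U)"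
    and "\<forall>U \<sigma>. \<forall>s\<in>structs F U. finite U \<and> inj_on \<sigma> U \<longrightarrow>
      \<eta> (\<sigma> ` U) (transport F U \<sigma> s) = transport G U \<sigma> (\<eta> U s)"
    by (elim conjE exE)
  then show thesis
    by (intro that[of \<eta>]) simp_all
qed

lemma species_iso_sym:
  fixes F :: "('a, 's) species" and G :: "('a, 't) species"
  assumes "F \<cong>\<^sub>S G"
  shows "G \<cong>\<^sub>S F"
proof -
  obtain \<eta> where F: "is_species F" and G: "is_species G"
    and bij: "\<And>U. finite U \<Longrightarrow> bij_betw (\<eta> U) (structs F U) (structs G U)"
    and nat: "\<And>U \<sigma> s. \<lbrakk>finite U; inj_on \<sigma> U; s \<in> structs F U\<rbrakk>
      \<Longrightarrow> \<eta> (\<sigma> ` U) (transport F U \<sigma> s) = transport G U \<sigma> (\<eta> U s)"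
    using assms by (rule species_isoE) (rule that)
  show ?thesis
  proof (rule species_isoI[where \<eta> = "\<lambda>U. inv_into (structs F U) (\<eta> U)"])
    fix U and \<sigma> :: "'a \<Rightarrow> 'a" and t assume U: "finite U" "inj_on \<sigma> U" and t: "t \<in> structs G U"
    define s where "s = inv_into (structs F U) (\<eta> U) t"
    have s: "s \<in> structs F U" and ts: "t = \<eta> U s"
      using bij_betwE[OF bij_betw_inv_into[OF bij[OF U(1)]]]
        bij_betw_inv_into_right[OF bij[OF U(1)] t] t
      by (simp_all add: s_def)
    have "transport F U \<sigma> s \<in> structs F (\<sigma> ` U)"
      using is_species.transport_in_structs[OF F] U s by blast
    moreover have "\<eta> (\<sigma> ` U) (transport F U \<sigma> s) = transport G U \<sigma> t"
      using nat U s ts by simp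
    moreover have "bij_betw (\<eta> (\<sigma> ` U)) (structs F (\<sigma> ` U)) (structs G (\<sigma> ` U))"
      using bij U by simp
    ultimately show "inv_into (structs F (\<sigma> ` U)) (\<eta> (\<sigma> ` U)) (transport G U \<sigma> t)
        = transport F U \<sigma> (inv_into (structs F U) (\<eta> U) t)"
      unfolding s_def[symmetric] by (metis bij_betw_inv_into_left)
  qed (simp_all add: F G bij bij_betw_inv_into)
qed

lemma species_iso_trans [trans]:
  fixes F :: "('a, 's) species" and G :: "('a, 't) species" and H :: "('a, 'r) species"
  assumes "F \<cong>\<^sub>S G" "G \<cong>\<^sub>S H"
  shows "F \<cong>\<^sub>S H"
proof -
  obtain \<eta> where F: "is_species F" and G: "is_species G"
    and bij: "\<And>U. finite U \<Longrightarrow> bij_betw (\<eta> U) (structs F U) (structs G U)"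
    and nat: "\<And>U \<sigma> s. \<lbrakk>finite U; inj_on \<sigma> U; s \<in> structs F U\<rbrakk>
      \<Longrightarrow> \<eta> (\<sigma> ` U) (transport F U \<sigma> s) = transport G U \<sigma> (\<eta> U s)"
    using assms(1) by (rule species_isoE) (rule that)
  obtain \<theta> where H: "is_species H"
    and bij': "\<And>U. finite U \<Longrightarrow> bij_betw (\<theta> U) (structs G U) (structs H U)"
    and nat': "\<And>U \<sigma> s. \<lbrakk>finite U; inj_on \<sigma> U; s \<in> structs G U\<rbrakk>
      \<Longrightarrow> \<theta> (\<sigma> ` U) (transport G U \<sigma> s) = transport H U \<sigma> (\<theta> U s)"
    using assms(2) by (rule species_isoE) (rule that)
  show ?thesis
  proof (rule species_isoI[where \<eta> = "\<lambda>U. \<theta> U \<circ> \<eta> U"])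
    fix U and \<sigma> :: "'a \<Rightarrow> 'a" and s assume U: "finite U" "inj_on \<sigma> U" and s: "s \<in> structs F U"
    then have "\<eta> U s \<in> structs G U"
      using bij by (meson bij_betwE)
    then show "(\<theta> (\<sigma> ` U) \<circ> \<eta> (\<sigma> ` U)) (transport F U \<sigma> s)
        = transport H U \<sigma> ((\<theta> U \<circ> \<eta> U) s)"
      using nat nat' U s by simp
  qed (simp_all add: F H bij_betw_trans[OF bij bij'])
qed

section \<open>Sums, products and compositions of species\<close>

lemma is_species_one: "is_species 1\<^sub>S"
  by unfold_locales (auto simp: species_one_def split: if_splits)

lemma is_species_X: "is_species X\<^sub>S"
  by unfold_locales (auto simp: species_X_def card_image split: if_splits)

lemma is_species_sets: "is_species E\<^sub>S"
  by unfold_locales (auto simp: species_sets_def)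

lemma is_species_sum:
  fixes F :: "('a, 's) species" and G :: "('a, 't) species"
  assumes "is_species F" "is_species G"
  shows "is_species (F +\<^sub>S G)"
proof -
  interpret F: is_species F by fact
  interpret G: is_species G by fact
  show ?thesis
  proof
    fix U :: "'a set" and \<sigma> \<tau> :: "'a \<Rightarrow> 'a" and s
    assume U: "finite U" "inj_on \<sigma> U" "\<And>x. x \<in> U \<Longrightarrow> \<sigma> x = \<tau> x"
      and "s \<in> structs (F +\<^sub>S G) U"
    then show "transport (F +\<^sub>S G) U \<sigma> s = transport (F +\<^sub>S G) U \<tau> s"
      using F.transport_cong[OF U] G.transport_cong[OF U] by (auto simp: species_sum_def)
  qed (auto simp: species_sum_def F.finite_structs G.finite_structs F.transport_in_structs
      G.transport_in_structs F.transport_id G.transport_id F.transport_comp G.transport_comp)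
qed

lemma is_species_prod:
  fixes F :: "('a, 's) species" and G :: "('a, 't) species"
  assumes "is_species F" "is_species G"
  shows "is_species (F \<cdot>\<^sub>S G)"
proof -
  interpret F: is_species F by fact
  interpret G: is_species G by fact
  show ?thesis
  proof
    fix U :: "'a set" assume U: "finite U"
    have "structs (F \<cdot>\<^sub>S G) U
        \<subseteq> (\<Union>A\<in>Pow U. \<Union>B\<in>Pow U. {A} \<times> {B} \<times> structs F A \<times> structs G B)"
      by (auto simp: species_prod_def)
    moreover have "finite \<dots>"
      using U by (auto intro!: finite_UN_I finite_cartesian_product F.finite_structs
          G.finite_structs intro: finite_subset)
    ultimately show "finite (structs (F \<cdot>\<^sub>S G) U)"
      by (rule finite_subset)
  next
    fix U :: "'a set" and \<sigma> :: "'a \<Rightarrow> 'a" and x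
    assume *: "finite U" "inj_on \<sigma> U" "x \<in> structs (F \<cdot>\<^sub>S G) U"
    then obtain A B s t where x: "x = (A, B, s, t)" and AB: "A \<union> B = U" "A \<inter> B = {}"
      and st: "s \<in> structs F A" "t \<in> structs G B"
      by (auto simp: species_prod_def)
    have "\<sigma> ` A \<inter> \<sigma> ` B = {}"
      using * AB by (auto simp: inj_on_def)
    then show "transport (F \<cdot>\<^sub>S G) U \<sigma> x \<in> structs (F \<cdot>\<^sub>S G) (\<sigma> ` U)"
      using * AB st x
      by (auto simp: species_prod_def inj_on_Un
          intro!: F.transport_in_structs G.transport_in_structs)
  next
    fix U :: "'a set" and \<sigma> \<tau> :: "'a \<Rightarrow> 'a" and x
    assume "finite U" "inj_on \<sigma> U" "\<And>x. x \<in> U \<Longrightarrow> \<sigma> x = \<tau> x" "x \<in> structs (F \<cdot>\<^sub>S G) U"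
    then show "transport (F \<cdot>\<^sub>S G) U \<sigma> x = transport (F \<cdot>\<^sub>S G) U \<tau> x"
      by (auto simp: species_prod_def inj_on_Un
          intro!: F.transport_cong G.transport_cong image_cong)
  next
    fix U :: "'a set" and x
    assume "finite U" "x \<in> structs (F \<cdot>\<^sub>S G) U"
    then show "transport (F \<cdot>\<^sub>S G) U id x = x"
      by (auto simp: species_prod_def F.transport_id G.transport_id)
  next
    fix U :: "'a set" and \<sigma> \<tau> :: "'a \<Rightarrow> 'a" and x
    assume "finite U" "inj_on \<sigma> U" "inj_on \<tau> (\<sigma> ` U)" "x \<in> structs (F \<cdot>\<^sub>S G) U"
    then show "transport (F \<cdot>\<^sub>S G) U (\<tau> \<circ> \<sigma>) x
        = transport (F \<cdot>\<^sub>S G) (\<sigma> ` U) \<tau> (transport (F \<cdot>\<^sub>S G) U \<sigma> x)"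
      by (auto simp: species_prod_def image_Un inj_on_Un image_comp
          F.transport_comp G.transport_comp)
  qed
qed

lemma species_prod_cong_right:
  fixes F :: "('a, 's) species" and G :: "('a, 't) species" and H :: "('a, 'r) species"
  assumes H: "is_species H" and "F \<cong>\<^sub>S G"
  shows "H \<cdot>\<^sub>S F \<cong>\<^sub>S H \<cdot>\<^sub>S G"
proof -
  obtain \<eta> where F: "is_species F" and G: "is_species G"
    and bij: "\<And>U. finite U \<Longrightarrow> bij_betw (\<eta> U) (structs F U) (structs G U)"
    and nat: "\<And>U \<sigma> s. \<lbrakk>finite U; inj_on \<sigma> U; s \<in> structs F U\<rbrakk>
      \<Longrightarrow> \<eta> (\<sigma> ` U) (transport F U \<sigma> s) = transport G U \<sigma> (\<eta> U s)"
    using assms(2) by (rule species_isoE) (rule that)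
  show ?thesis
  proof (rule species_isoI[where \<eta> = "\<lambda>U (A, B, s, t). (A, B, s, \<eta> B t)"])
    fix U :: "'a set" assume U: "finite U"
    have "bij_betw (\<eta> B) (structs F B) (structs G B)" if "B \<subseteq> U" for B
      using bij that U finite_subset by blast
    note b = bij_betw_inv_into_left[OF this] bij_betw_inv_into_right[OF this]
      bij_betwE[OF this] bij_betwE[OF bij_betw_inv_into[OF this]]
    show "bij_betw (\<lambda>(A, B, s, t). (A, B, s, \<eta> B t)) (structs (H \<cdot>\<^sub>S F) U) (structs (H \<cdot>\<^sub>S G) U)"
      by (rule bij_betwI[where g = "\<lambda>(A, B, s, t). (A, B, s, inv_into (structs F B) (\<eta> B) t)"])
        (auto simp: species_prod_def b)
  next
    fix U and \<sigma> :: "'a \<Rightarrow> 'a" and x assume U: "finite U" "inj_on \<sigma> U" and x: "x \<in> structs (H \<cdot>\<^sub>S F) U"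
    then show "(\<lambda>(A, B, s, t). (A, B, s, \<eta> B t)) (transport (H \<cdot>\<^sub>S F) U \<sigma> x)
        = transport (H \<cdot>\<^sub>S G) U \<sigma> ((\<lambda>(A, B, s, t). (A, B, s, \<eta> B t)) x)"
      by (auto simp: species_prod_def inj_on_Un nat)
  qed (simp_all add: H F G is_species_prod)
qed

lemma inj_on_image_partition:
  assumes "partition_on U \<pi>" "inj_on \<sigma> U"
  shows "inj_on ((`) \<sigma>) \<pi>"
  using inj_on_image_Pow[OF assms(2)] partition_onD1[OF assms(1)]
  by (auto intro: inj_on_subset)

lemma partition_on_image:
  assumes "partition_on U \<pi>" "inj_on \<sigma> U"
  shows "partition_on (\<sigma> ` U) ((`) \<sigma> ` \<pi>)"
proof -
  have "(`) \<sigma> ` \<pi> - {{}} = (`) \<sigma> ` \<pi>"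
    using partition_onD3[OF assms(1)] by auto
  then show ?thesis
    using partition_on_inj_image[OF assms] by simp
qed

text \<open>
  The inverse image of a block in the definition of composition disappears once the block is
  presented as an image; all later calculations with transport use this form.
\<close>

lemma transport_comp_family:
  assumes "partition_on U \<pi>" "inj_on \<sigma> U" "B \<in> \<pi>"
  shows "snd (snd (transport (F \<circ>\<^sub>S G) U \<sigma> (\<pi>, s, g))) (\<sigma> ` B) = transport G B \<sigma> (g B)"
  using assms inj_on_image_partition[OF assms(1,2)]
  by (simp add: species_comp_def Let_def)

lemma is_species_comp:
  fixes F :: "('a set, 's) species" and G :: "('a, 't) species"
  assumes "is_species F" "is_species G"
  shows "is_species (F \<circ>\<^sub>S G)"
proof -
  interpret F: is_species F by fact
  interpret G: is_species G by fact
  have block: "B \<subseteq> U" "finite B" if "finite U" "partition_on U \<pi>" "B \<in> \<pi>" for U \<pi> and B :: "'a set"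
    using that partition_onD1 by (blast, metis Union_upper finite_subset partition_onD1)
  show ?thesis
  proof
    fix U :: "'a set" assume U: "finite U"
    have "structs (F \<circ>\<^sub>S G) U \<subseteq> (\<Union>\<pi>\<in>{\<pi>. partition_on U \<pi>}.
        {\<pi>} \<times> structs F \<pi> \<times> (\<Pi>\<^sub>E B\<in>\<pi>. structs G B))"
      by (auto simp: species_comp_def)
    moreover have "finite \<dots>"
      using U by (auto intro!: finite_UN_I finite_cartesian_product finite_PiE
          F.finite_structs G.finite_structs finitely_many_partition_on
          intro: finite_elements block)
    ultimately show "finite (structs (F \<circ>\<^sub>S G) U)"
      by (rule finite_subset)
  next
    fix U :: "'a set" and \<sigma> :: "'a \<Rightarrow> 'a" and x
    assume U: "finite U" "inj_on \<sigma> U" and "x \<in> structs (F \<circ>\<^sub>S G) U"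
    then obtain \<pi> s g where x: "x = (\<pi>, s, g)" and \<pi>: "partition_on U \<pi>"
      and s: "s \<in> structs F \<pi>" and g: "g \<in> (\<Pi>\<^sub>E B\<in>\<pi>. structs G B)"
      by (auto simp: species_comp_def)
    have "transport G B \<sigma> (g B) \<in> structs G (\<sigma> ` B)" if "B \<in> \<pi>" for B
      using g that U block[OF U(1) \<pi> that] by (auto intro!: G.transport_in_structs intro: inj_on_subset)
    then show "transport (F \<circ>\<^sub>S G) U \<sigma> x \<in> structs (F \<circ>\<^sub>S G) (\<sigma> ` U)"
      using inj_on_image_partition[OF \<pi> U(2)] partition_on_image[OF \<pi> U(2)] s x
        finite_elements[OF U(1) \<pi>]
      by (auto simp: species_comp_def Let_def intro!: F.transport_in_structs)
  next
    fix U :: "'a set" and \<sigma> \<tau> :: "'a \<Rightarrow> 'a" and x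
    assume U: "finite U" "inj_on \<sigma> U" and eq: "\<And>x. x \<in> U \<Longrightarrow> \<sigma> x = \<tau> x"
      and "x \<in> structs (F \<circ>\<^sub>S G) U"
    then obtain \<pi> s g where x: "x = (\<pi>, s, g)" and \<pi>: "partition_on U \<pi>"
      and s: "s \<in> structs F \<pi>" and g: "g \<in> (\<Pi>\<^sub>E B\<in>\<pi>. structs G B)"
      by (auto simp: species_comp_def)
    have im: "\<sigma> ` B = \<tau> ` B" if "B \<in> \<pi>" for B
      using eq block[OF U(1) \<pi> that] by (auto intro!: image_cong)
    have im\<pi>: "(`) \<sigma> ` \<pi> = (`) \<tau> ` \<pi>"
      using im by (auto intro!: image_cong)
    have inj: "inj_on \<tau> U"
      using U(2) eq inj_on_cong by blast
    have "transport G B \<sigma> (g B) = transport G B \<tau> (g B)" if "B \<in> \<pi>" for B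
      using g that U eq block[OF U(1) \<pi> that]
      by (intro G.transport_cong) (auto intro: inj_on_subset)
    then have "snd (snd (transport (F \<circ>\<^sub>S G) U \<sigma> x)) (\<sigma> ` B)
        = snd (snd (transport (F \<circ>\<^sub>S G) U \<tau> x)) (\<sigma> ` B)" if "B \<in> \<pi>" for B
      unfolding x
      using transport_comp_family[OF \<pi> U(2) that] transport_comp_family[OF \<pi> inj that] im that
      by metis
    moreover have F: "transport F \<pi> ((`) \<sigma>) s = transport F \<pi> ((`) \<tau>) s"
      using finite_elements[OF U(1) \<pi>] inj_on_image_partition[OF \<pi> U(2)] im s
      by (intro F.transport_cong)
    ultimately have "snd (snd (transport (F \<circ>\<^sub>S G) U \<sigma> x)) C
        = snd (snd (transport (F \<circ>\<^sub>S G) U \<tau> x)) C" if "C \<in> (`) \<tau> ` \<pi>" for C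
      using that im by auto
    with F show "transport (F \<circ>\<^sub>S G) U \<sigma> x = transport (F \<circ>\<^sub>S G) U \<tau> x"
      by (simp add: species_comp_def x im\<pi> cong: restrict_cong)
  next
    fix U :: "'a set" and x
    assume U: "finite U" and "x \<in> structs (F \<circ>\<^sub>S G) U"
    then obtain \<pi> s g where x: "x = (\<pi>, s, g)" and \<pi>: "partition_on U \<pi>"
      and s: "s \<in> structs F \<pi>" and g: "g \<in> (\<Pi>\<^sub>E B\<in>\<pi>. structs G B)"
      by (auto simp: species_comp_def)
    have "transport G B id (g B) = g B" if "B \<in> \<pi>" for B
      using g that block[OF U \<pi> that] by (auto intro!: G.transport_id)
    then have "(\<lambda>C\<in>\<pi>. transport G C id (g C)) = g"
      using g by (intro ext) (auto simp: restrict_def PiE_def extensional_def)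
    moreover have "inv_into \<pi> (\<lambda>B. B) C = C" if "C \<in> \<pi>" for C
      using that by (intro inv_into_f_eq) (auto simp: inj_on_def)
    moreover have "(`) (\<lambda>x. x) = (\<lambda>B :: 'a set. B)"
      by auto
    ultimately show "transport (F \<circ>\<^sub>S G) U id x = x"
      using F.transport_id[of \<pi> s] s finite_elements[OF U \<pi>]
      by (simp add: species_comp_def x Let_def id_def cong: restrict_cong)
  next
    fix U :: "'a set" and \<sigma> \<tau> :: "'a \<Rightarrow> 'a" and x
    assume U: "finite U" "inj_on \<sigma> U" "inj_on \<tau> (\<sigma> ` U)" and "x \<in> structs (F \<circ>\<^sub>S G) U"
    then obtain \<pi> s g where x: "x = (\<pi>, s, g)" and \<pi>: "partition_on U \<pi>"
      and s: "s \<in> structs F \<pi>" and g: "g \<in> (\<Pi>\<^sub>E B\<in>\<pi>. structs G B)"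
      by (auto simp: species_comp_def)
    let ?\<pi> = "(`) \<sigma> ` \<pi>" and ?y = "transport (F \<circ>\<^sub>S G) U \<sigma> x"
    define h where "h = snd (snd ?y)"
    have y: "?y = (?\<pi>, transport F \<pi> ((`) \<sigma>) s, h)"
      by (simp add: species_comp_def x h_def)
    have \<pi>': "partition_on (\<sigma> ` U) ?\<pi>"
      by (rule partition_on_image[OF \<pi> U(2)])
    have inj: "inj_on (\<tau> \<circ> \<sigma>) U"
      using U by (auto intro: comp_inj_on)
    have "snd (snd (transport (F \<circ>\<^sub>S G) U (\<tau> \<circ> \<sigma>) x)) (\<tau> ` \<sigma> ` B)
        = snd (snd (transport (F \<circ>\<^sub>S G) (\<sigma> ` U) \<tau> ?y)) (\<tau> ` \<sigma> ` B)" if B: "B \<in> \<pi>" for B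
    proof -
      have "h (\<sigma> ` B) = transport G B \<sigma> (g B)"
        unfolding h_def x by (rule transport_comp_family[OF \<pi> U(2) B])
      moreover have "transport G B (\<tau> \<circ> \<sigma>) (g B) = transport G (\<sigma> ` B) \<tau> (transport G B \<sigma> (g B))"
        using g B U block[OF U(1) \<pi> B]
        by (intro G.transport_comp) (auto intro: inj_on_subset image_mono)
      ultimately show ?thesis
        using transport_comp_family[OF \<pi> inj B, of F G s g]
          transport_comp_family[OF \<pi>' U(3), of "\<sigma> ` B" F G "transport F \<pi> ((`) \<sigma>) s" h] B
        unfolding y unfolding x by (simp add: image_comp)
    qed
    moreover have "transport F \<pi> ((`) (\<tau> \<circ> \<sigma>)) s
        = transport F ?\<pi> ((`) \<tau>) (transport F \<pi> ((`) \<sigma>) s)"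
    proof -
      have "(`) (\<tau> \<circ> \<sigma>) = (`) \<tau> \<circ> (`) \<sigma>"
        by (auto simp: image_comp)
      then show ?thesis
        using F.transport_comp[OF finite_elements[OF U(1) \<pi>]
            inj_on_image_partition[OF \<pi> U(2)] inj_on_image_partition[OF \<pi>' U(3)] s]
        by simp
    qed
    moreover have "(`) (\<tau> \<circ> \<sigma>) ` \<pi> = (`) \<tau> ` ?\<pi>"
      by (auto simp: image_comp)
    ultimately show "transport (F \<circ>\<^sub>S G) U (\<tau> \<circ> \<sigma>) x = transport (F \<circ>\<^sub>S G) (\<sigma> ` U) \<tau> ?y"
      unfolding y unfolding x by (auto simp: species_comp_def intro!: restrict_ext)
  qed
qed

section \<open>Relabelling of graphs\<close>

lemma pair_graph_iff:
  "pair_graph G \<longleftrightarrow> finite (pverts G) \<and> parcs G \<subseteq> pverts G \<times> pverts G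
    \<and> sym (parcs G) \<and> irrefl (parcs G)"
proof
  assume "pair_graph G"
  then interpret pair_graph G .
  show "finite (pverts G) \<and> parcs G \<subseteq> pverts G \<times> pverts G \<and> sym (parcs G) \<and> irrefl (parcs G)"
    using arcs_symmetric no_loops' in_arcsD1 in_arcsD2
    by (auto simp: irrefl_def intro: symI)
next
  assume *: "finite (pverts G) \<and> parcs G \<subseteq> pverts G \<times> pverts G \<and> sym (parcs G) \<and> irrefl (parcs G)"
  then have "finite (parcs G)"
    by (meson finite_SigmaI finite_subset)
  with * show "pair_graph G"
    by unfold_locales (auto simp: irrefl_def symmetric_def)
qed

text \<open>
  Connectedness is reachability within the vertex set of the symmetrized digraph. The arcs of a
  simple graph are already symmetric and stay inside the vertex set, so this is the plain
  reflexive-transitive closure.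
\<close>

lemma connected_iff:
  assumes "pair_graph G"
  shows "connected (with_proj G) \<longleftrightarrow>
    pverts G \<noteq> {} \<and> (\<forall>u\<in>pverts G. \<forall>v\<in>pverts G. (u, v) \<in> (parcs G)\<^sup>*)"
proof -
  have G: "parcs G \<subseteq> pverts G \<times> pverts G" "sym (parcs G)"
    using assms by (auto simp: pair_graph_iff)
  have "parcs (mk_symmetric (with_proj G)) = parcs G"
    using G(2) by (auto simp: parcs_mk_symmetric dest: symD)
  moreover have "(u, v) \<in> rtrancl_on (pverts G) (parcs G) \<longleftrightarrow> (u, v) \<in> (parcs G)\<^sup>*"
    if "u \<in> pverts G" "v \<in> pverts G" for u v
    using that G(1) by (auto intro: rtrancl_on_rtranclI rtrancl_consistent_rtrancl_on)
  ultimately show ?thesis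
    by (simp add: connected_def strongly_connected_def reachable_def)
qed

lemma relabel_simps [simp]:
  "pverts (relabel \<sigma> G) = \<sigma> ` pverts G"
  "parcs (relabel \<sigma> G) = map_prod \<sigma> \<sigma> ` parcs G"
  by (simp_all add: relabel_def)

lemma relabel_arc_iff:
  assumes "pair_graph G" "inj_on \<sigma> (pverts G)" "u \<in> pverts G" "v \<in> pverts G"
  shows "(\<sigma> u, \<sigma> v) \<in> map_prod \<sigma> \<sigma> ` parcs G \<longleftrightarrow> (u, v) \<in> parcs G"
proof
  assume "(\<sigma> u, \<sigma> v) \<in> map_prod \<sigma> \<sigma> ` parcs G"
  then obtain a b where ab: "(a, b) \<in> parcs G" "\<sigma> u = \<sigma> a" "\<sigma> v = \<sigma> b"
    by auto
  moreover have "a \<in> pverts G" "b \<in> pverts G"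
    using ab(1) assms(1) by (auto simp: pair_graph_iff)
  ultimately show "(u, v) \<in> parcs G"
    using assms by (simp add: inj_on_eq_iff)
qed (auto intro: rev_image_eqI)

lemma pair_graph_relabel:
  assumes "pair_graph G" "inj_on \<sigma> (pverts G)"
  shows "pair_graph (relabel \<sigma> G)"
proof -
  have "\<sigma> u \<noteq> \<sigma> v" if "(u, v) \<in> parcs G" for u v
  proof -
    have "u \<in> pverts G" "v \<in> pverts G" "u \<noteq> v"
      using that assms(1) by (auto simp: pair_graph_iff irrefl_def)
    then show ?thesis
      using assms(2) by (simp add: inj_on_eq_iff)
  qed
  then have "irrefl (map_prod \<sigma> \<sigma> ` parcs G)"
    by (auto simp: irrefl_def)
  moreover have "sym (map_prod \<sigma> \<sigma> ` parcs G)"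
  proof (rule symI)
    fix x y assume "(x, y) \<in> map_prod \<sigma> \<sigma> ` parcs G"
    then obtain u v where "x = \<sigma> u" "y = \<sigma> v" "(u, v) \<in> parcs G"
      by auto
    moreover from this have "(v, u) \<in> parcs G"
      using assms(1) by (auto simp: pair_graph_iff dest: symD)
    ultimately show "(y, x) \<in> map_prod \<sigma> \<sigma> ` parcs G"
      by (auto intro: rev_image_eqI)
  qed
  ultimately show ?thesis
    using assms by (auto simp: pair_graph_iff)
qed

text \<open>
  An implication expresses invariance, because relabelling back by an inverse of \<open>\<sigma>\<close> gives the
  converse.
\<close>

definition iso_invariant :: "('a pair_pre_digraph \<Rightarrow> bool) \<Rightarrow> bool" where
  "iso_invariant \<Phi> \<longleftrightarrow>
    (\<forall>G \<sigma>. pair_graph G \<and> inj_on \<sigma> (pverts G) \<and> \<Phi> G \<longrightarrow> \<Phi> (relabel \<sigma> G))"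

lemma iso_invariant_conj:
  "iso_invariant \<Phi> \<Longrightarrow> iso_invariant \<Psi> \<Longrightarrow> iso_invariant (\<lambda>G. \<Phi> G \<and> \<Psi> G)"
  by (auto simp: iso_invariant_def)

lemma transport_graph_species: "transport (graph_species \<Phi>) U \<sigma> G = relabel \<sigma> G"
  by (simp add: graph_species_def)

lemma is_species_graph_species:
  assumes "iso_invariant \<Phi>"
  shows "is_species (graph_species \<Phi>)"
proof
  fix U :: "'a set" assume U: "finite U"
  have "structs (graph_species \<Phi>) U \<subseteq> (\<lambda>E. \<lparr>pverts = U, parcs = E\<rparr>) ` Pow (U \<times> U)"
  proof
    fix G assume "G \<in> structs (graph_species \<Phi>) U"
    then have "G = \<lparr>pverts = U, parcs = parcs G\<rparr>" "parcs G \<subseteq> U \<times> U"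
      by (auto simp: graph_species_def pair_graph_iff)
    then show "G \<in> (\<lambda>E. \<lparr>pverts = U, parcs = E\<rparr>) ` Pow (U \<times> U)"
      by blast
  qed
  then show "finite (structs (graph_species \<Phi>) U)"
    by (rule finite_subset) (use U in simp)
next
  fix U :: "'a set" and \<sigma> \<tau> :: "'a \<Rightarrow> 'a" and G
  assume eq: "\<And>x. x \<in> U \<Longrightarrow> \<sigma> x = \<tau> x" and G: "G \<in> structs (graph_species \<Phi>) U"
  have "map_prod \<sigma> \<sigma> ` parcs G = map_prod \<tau> \<tau> ` parcs G"
    using eq G by (intro image_cong) (auto simp: graph_species_def pair_graph_iff)
  moreover have "\<sigma> ` pverts G = \<tau> ` pverts G"
    using eq G by (intro image_cong) (auto simp: graph_species_def)
  ultimately show "transport (graph_species \<Phi>) U \<sigma> G = transport (graph_species \<Phi>) U \<tau> G"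
    by (simp add: graph_species_def relabel_def)
next
  fix U :: "'a set" and \<sigma> :: "'a \<Rightarrow> 'a" and G
  assume "inj_on \<sigma> U" "G \<in> structs (graph_species \<Phi>) U"
  then show "transport (graph_species \<Phi>) U \<sigma> G \<in> structs (graph_species \<Phi>) (\<sigma> ` U)"
    using assms by (auto simp: graph_species_def iso_invariant_def pair_graph_relabel)
qed (simp_all add: graph_species_def relabel_def prod.map_id0 map_prod_compose image_comp)

lemma neighborhood_relabel:
  assumes "pair_graph G" "inj_on \<sigma> (pverts G)" "v \<in> pverts G"
  shows "neighborhood (relabel \<sigma> G) (\<sigma> v) = \<sigma> ` neighborhood G v"
proof -
  have "{w \<in> \<sigma> ` pverts G. P w} = \<sigma> ` {w \<in> pverts G. P (\<sigma> w)}" for P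
    by auto
  then show ?thesis
    using relabel_arc_iff[OF assms]
    unfolding neighborhood_def relabel_simps by (simp cong: conj_cong)
qed

lemma neighborhood_subset: "neighborhood G v \<subseteq> pverts G"
  by (auto simp: neighborhood_def)

lemma iso_invariant_point_determining: "iso_invariant point_determining"
  unfolding iso_invariant_def
proof (intro allI impI, elim conjE)
  fix G :: "'a pair_pre_digraph" and \<sigma> :: "'a \<Rightarrow> 'a"
  assume G: "pair_graph G" "inj_on \<sigma> (pverts G)" "point_determining G"
  show "point_determining (relabel \<sigma> G)"
    using G(3) inj_on_image_eq_iff[OF G(2) neighborhood_subset neighborhood_subset]
    by (auto simp: point_determining_def neighborhood_relabel[OF G(1,2)])
qed

lemma pair_graph_complement:
  assumes "pair_graph G"
  shows "pair_graph (graph_complement G)"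
  using assms by (auto simp: pair_graph_iff graph_complement_def irrefl_def sym_def)

lemma pverts_complement [simp]: "pverts (graph_complement G) = pverts G"
  by (simp add: graph_complement_def)

lemma graph_complement_involution:
  assumes "pair_graph G"
  shows "graph_complement (graph_complement G) = G"
  using assms by (cases G) (auto simp: pair_graph_iff graph_complement_def irrefl_def)

lemma graph_complement_relabel:
  assumes "pair_graph G" "inj_on \<sigma> (pverts G)"
  shows "graph_complement (relabel \<sigma> G) = relabel \<sigma> (graph_complement G)"
proof -
  have "(x, y) \<in> parcs (graph_complement (relabel \<sigma> G))
      \<longleftrightarrow> (x, y) \<in> parcs (relabel \<sigma> (graph_complement G))" for x y
  proof (cases "x \<in> \<sigma> ` pverts G \<and> y \<in> \<sigma> ` pverts G")
    case True
    then obtain u v where uv: "x = \<sigma> u" "y = \<sigma> v" "u \<in> pverts G" "v \<in> pverts G"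
      by auto
    have "(x, y) \<in> parcs (graph_complement (relabel \<sigma> G)) \<longleftrightarrow> (u, v) \<in> parcs (graph_complement G)"
      using uv relabel_arc_iff[OF assms uv(3,4)] assms(2)
      by (simp add: graph_complement_def inj_on_eq_iff)
    also have "\<dots> \<longleftrightarrow> (x, y) \<in> parcs (relabel \<sigma> (graph_complement G))"
      using uv relabel_arc_iff[OF pair_graph_complement[OF assms(1)], of \<sigma> u v] assms(2)
      by simp
    finally show ?thesis .
  next
    case False
    then show ?thesis
      by (auto simp: graph_complement_def)
  qed
  then have "parcs (graph_complement (relabel \<sigma> G)) = parcs (relabel \<sigma> (graph_complement G))"
    by auto
  then show ?thesis
    by (intro pair_pre_digraph.equality) simp_all
qed

lemma iso_invariant_co_point_determining: "iso_invariant co_point_determining"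
  unfolding iso_invariant_def co_point_determining_def
proof (intro allI impI, elim conjE)
  fix G :: "'a pair_pre_digraph" and \<sigma> :: "'a \<Rightarrow> 'a"
  assume G: "pair_graph G" "inj_on \<sigma> (pverts G)" "point_determining (graph_complement G)"
  have "point_determining (relabel \<sigma> (graph_complement G))"
    using iso_invariant_point_determining pair_graph_complement[OF G(1)] G(2,3)
    unfolding iso_invariant_def pverts_complement[symmetric, of G] by blast
  then show "point_determining (graph_complement (relabel \<sigma> G))"
    by (simp add: graph_complement_relabel[OF G(1,2)])
qed

lemma point_determining_iso_co_point_determining: "\<P> \<cong>\<^sub>S \<Q>"
proof (rule species_isoI[where \<eta> = "\<lambda>U. graph_complement"])
  \<comment> \<open>On simple graphs complementation is its own inverse.\<close>
  show "bij_betw graph_complement (structs \<P> U) (structs \<Q> U)" for U :: "'a set"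
    by (rule bij_betwI[where g = graph_complement])
      (auto simp: \<P>_def \<Q>_def graph_species_def co_point_determining_def
        pair_graph_complement graph_complement_involution)
qed (auto simp: \<P>_def \<Q>_def graph_species_def graph_complement_relabel
    intro: is_species_graph_species[unfolded graph_species_def] iso_invariant_point_determining
      iso_invariant_co_point_determining)

section \<open>Connected components\<close>

definition induced :: "'a pair_pre_digraph \<Rightarrow> 'a set \<Rightarrow> 'a pair_pre_digraph" where
  "induced G B = \<lparr>pverts = B, parcs = parcs G \<inter> B \<times> B\<rparr>"

definition components :: "'a pair_pre_digraph \<Rightarrow> 'a set set" where
  "components G = pverts G // ((parcs G)\<^sup>* \<inter> pverts G \<times> pverts G)"

lemma induced_simps [simp]:
  "pverts (induced G B) = B" "parcs (induced G B) = parcs G \<inter> B \<times> B"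
  by (simp_all add: induced_def)

lemma pair_graph_induced:
  assumes "pair_graph G" "B \<subseteq> pverts G"
  shows "pair_graph (induced G B)"
  using assms by (auto simp: pair_graph_iff irrefl_def sym_def intro: finite_subset)

lemma equiv_reachable:
  assumes "pair_graph G"
  shows "equiv (pverts G) ((parcs G)\<^sup>* \<inter> pverts G \<times> pverts G)"
proof -
  have "sym ((parcs G)\<^sup>*)"
    using assms by (simp add: pair_graph_iff sym_rtrancl)
  then show ?thesis
    by (auto simp: refl_on_def sym_def trans_def intro!: equivI)
qed

lemma partition_on_components:
  "pair_graph G \<Longrightarrow> partition_on (pverts G) (components G)"
  unfolding components_def by (intro partition_on_quotient equiv_reachable)

text \<open>
  A path starting in a set that no arc leaves never uses an arc outside it. This turns
  reachability in the whole graph into reachability in an induced subgraph.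
\<close>

lemma rtrancl_within:
  assumes "(u, v) \<in> R\<^sup>*" "u \<in> B" "\<And>x y. (x, y) \<in> R \<Longrightarrow> x \<in> B \<Longrightarrow> y \<in> B"
  shows "v \<in> B \<and> (u, v) \<in> (R \<inter> B \<times> B)\<^sup>*"
  using assms(1)
proof induction
  case (step y z)
  then have "(y, z) \<in> R \<inter> B \<times> B"
    using assms(3) by blast
  with step show ?case
    by (auto intro: rtrancl_into_rtrancl)
qed (use assms(2) in auto)

lemma component_closed:
  assumes "pair_graph G" "B \<in> components G" "x \<in> B" "(x, y) \<in> parcs G"
  shows "y \<in> B"
  using assms unfolding components_def
  by (auto elim!: quotientE simp: pair_graph_iff intro: rtrancl_into_rtrancl)

lemma connected_component:
  assumes G: "pair_graph G" and B: "B \<in> components G"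
  shows "connected (with_proj (induced G B))"
proof -
  note part = partition_on_components[OF G]
  have sub: "B \<subseteq> pverts G" and ne: "B \<noteq> {}"
    using part B by (auto simp: partition_on_def)
  have "(u, v) \<in> (parcs G \<inter> B \<times> B)\<^sup>*" if "u \<in> B" "v \<in> B" for u v
  proof -
    have "(u, v) \<in> (parcs G)\<^sup>*"
      using quotient_eq_iff[OF equiv_reachable[OF G], of B B u v] B that
      by (simp add: components_def)
    then show ?thesis
      using rtrancl_within[of u v "parcs G" B] component_closed[OF G B] that by blast
  qed
  then show ?thesis
    using connected_iff[OF pair_graph_induced[OF G sub]] ne by simp
qed

lemma parcs_components:
  assumes "pair_graph G"
  shows "(\<Union>B\<in>components G. parcs (induced G B)) = parcs G"
proof -
  have "\<exists>B\<in>components G. u \<in> B \<and> v \<in> B" if "(u, v) \<in> parcs G" for u v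
  proof -
    have "u \<in> pverts G"
      using assms that by (auto simp: pair_graph_iff)
    then obtain B where "B \<in> components G" "u \<in> B"
      using partition_on_components[OF assms] by (auto simp: partition_on_def)
    then show ?thesis
      using component_closed[OF assms _ _ that] by blast
  qed
  then show ?thesis
    by fastforce
qed

text \<open>
  No arc leaves a block, and inside a block everything is reachable; hence reachability is the
  equivalence relation of the partition. This is how the partition of a composite structure is
  recovered from the union of its graphs.
\<close>

lemma components_unique:
  assumes G: "pair_graph G" and \<pi>: "partition_on (pverts G) \<pi>"
    and arcs: "parcs G \<subseteq> (\<Union>B\<in>\<pi>. B \<times> B)"
    and conn: "\<And>B. B \<in> \<pi> \<Longrightarrow> connected (with_proj (induced G B))"
  shows "components G = \<pi>"
proof -
  have closed: "y \<in> B" if "B \<in> \<pi>" "x \<in> B" and xy: "(x, y) \<in> parcs G" for B x y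
  proof -
    obtain C where "C \<in> \<pi>" "x \<in> C" "y \<in> C"
      using subsetD[OF arcs xy] by blast
    then show ?thesis
      using partition_onD2[OF \<pi>] that by (auto dest: disjointD)
  qed
  have "(parcs G)\<^sup>* \<inter> pverts G \<times> pverts G = {(x, y). \<exists>B\<in>\<pi>. x \<in> B \<and> y \<in> B}"
  proof (intro set_eqI iffI; clarify)
    fix x y assume xy: "(x, y) \<in> (parcs G)\<^sup>*" "x \<in> pverts G"
    then obtain B where "B \<in> \<pi>" "x \<in> B"
      using \<pi> by (auto simp: partition_on_def)
    then show "\<exists>B\<in>\<pi>. x \<in> B \<and> y \<in> B"
      using rtrancl_within[OF xy(1)] closed by blast
  next
    fix x y B assume B: "B \<in> \<pi>" "x \<in> B" "y \<in> B"
    then have sub: "B \<subseteq> pverts G"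
      using \<pi> by (auto simp: partition_on_def)
    then have "(x, y) \<in> (parcs G \<inter> B \<times> B)\<^sup>*"
      using connected_iff[OF pair_graph_induced[OF G sub]] conn B by simp
    then have "(x, y) \<in> (parcs G)\<^sup>*"
      by (rule rtrancl_mono[THEN subsetD, rotated]) simp
    then show "(x, y) \<in> (parcs G)\<^sup>* \<inter> pverts G \<times> pverts G"
      using sub B by blast
  qed
  then show ?thesis
    unfolding components_def using partition_on_eq_quotient[OF \<pi>] by simp
qed

lemma iso_invariant_connected: "iso_invariant (\<lambda>G. connected (with_proj G))"
  unfolding iso_invariant_def
proof (intro allI impI, elim conjE)
  fix G :: "'a pair_pre_digraph" and \<sigma> :: "'a \<Rightarrow> 'a"
  assume G: "pair_graph G" "inj_on \<sigma> (pverts G)" "connected (with_proj G)"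
  have "(\<sigma> u, \<sigma> v) \<in> (map_prod \<sigma> \<sigma> ` parcs G)\<^sup>*" if "(u, v) \<in> (parcs G)\<^sup>*" for u v
    using that by induction (auto intro: rtrancl_into_rtrancl rev_image_eqI)
  then show "connected (with_proj (relabel \<sigma> G))"
    using G(3) by (auto simp: connected_iff[OF G(1)] connected_iff[OF pair_graph_relabel[OF G(1,2)]])
qed

definition block_union :: "'a set set \<Rightarrow> ('a set \<Rightarrow> 'a pair_pre_digraph) \<Rightarrow> 'a pair_pre_digraph" where
  "block_union \<pi> g = \<lparr>pverts = \<Union>\<pi>, parcs = \<Union>B\<in>\<pi>. parcs (g B)\<rparr>"

lemma block_union_simps [simp]:
  "pverts (block_union \<pi> g) = \<Union>\<pi>" "parcs (block_union \<pi> g) = (\<Union>B\<in>\<pi>. parcs (g B))"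
  by (simp_all add: block_union_def)

lemma pair_graph_block_union:
  assumes "finite (\<Union>\<pi>)" "\<And>B. B \<in> \<pi> \<Longrightarrow> pair_graph (g B)" "\<And>B. B \<in> \<pi> \<Longrightarrow> pverts (g B) = B"
  shows "pair_graph (block_union \<pi> g)"
  using assms unfolding pair_graph_iff block_union_simps
  by (fastforce simp: irrefl_def sym_def)

lemma induced_block_union:
  assumes "disjoint \<pi>" "\<And>B. B \<in> \<pi> \<Longrightarrow> pair_graph (g B)" "\<And>B. B \<in> \<pi> \<Longrightarrow> pverts (g B) = B"
    and B: "B \<in> \<pi>"
  shows "induced (block_union \<pi> g) B = g B"
proof -
  have sub: "parcs (g C) \<subseteq> C \<times> C" if "C \<in> \<pi>" for C
    using assms that by (auto simp: pair_graph_iff)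
  have "C = B" if "C \<in> \<pi>" "(x, y) \<in> parcs (g C)" "x \<in> B" for C x y
    using sub[OF that(1)] that B disjointD[OF assms(1)] by blast
  then have "(\<Union>C\<in>\<pi>. parcs (g C)) \<inter> B \<times> B = parcs (g B)"
    using sub[OF B] B by blast
  then show ?thesis
    using assms(3)[OF B] by (simp add: induced_def)
qed

lemma components_block_union:
  assumes "finite U" and \<pi>: "partition_on U \<pi>"
    and g: "\<And>B. B \<in> \<pi> \<Longrightarrow> pair_graph (g B)" "\<And>B. B \<in> \<pi> \<Longrightarrow> pverts (g B) = B"
      "\<And>B. B \<in> \<pi> \<Longrightarrow> connected (with_proj (g B))"
  shows "components (block_union \<pi> g) = \<pi>"
proof (rule components_unique)
  have U: "U = \<Union>\<pi>"
    using \<pi> by (rule partition_onD1)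
  show "pair_graph (block_union \<pi> g)"
    using assms U by (intro pair_graph_block_union) auto
  show "partition_on (pverts (block_union \<pi> g)) \<pi>"
    using \<pi> U by simp
  show "parcs (block_union \<pi> g) \<subseteq> (\<Union>B\<in>\<pi>. B \<times> B)"
    using g by (fastforce simp: pair_graph_iff)
  show "connected (with_proj (induced (block_union \<pi> g) B))" if "B \<in> \<pi>" for B
    using induced_block_union[OF partition_onD2[OF \<pi>] g(1,2) that] g(3)[OF that] by simp
qed

lemma relabel_block_union:
  assumes "\<And>B. B \<in> \<pi> \<Longrightarrow> h (\<sigma> ` B) = relabel \<sigma> (g B)"
  shows "block_union ((`) \<sigma> ` \<pi>) h = relabel \<sigma> (block_union \<pi> g)"
  using assms by (simp add: block_union_def relabel_def image_UN image_Union)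

text \<open>
  A set of connected graphs on the blocks of a partition is sent to its union. The inverse takes
  a graph to its components with their induced subgraphs. The hypothesis \<open>local\<close> says that
  membership in the class \<open>\<Phi>\<close> is tested by \<open>\<Psi>\<close> on components; allowing \<open>\<Psi>\<close> to differ from
  \<open>\<Phi>\<close> lets a condition such as having no isolated vertex become a size condition on
  components.
\<close>

theorem sets_of_connected_graphs:
  fixes \<Phi> \<Psi> :: "'a pair_pre_digraph \<Rightarrow> bool"
  assumes inv: "iso_invariant \<Phi>" "iso_invariant \<Psi>"
    and local: "\<And>G. pair_graph G \<Longrightarrow> \<Phi> G \<longleftrightarrow> (\<forall>B\<in>components G. \<Psi> (induced G B))"
  shows "E\<^sub>S \<circ>\<^sub>S graph_species (\<lambda>G. connected (with_proj G) \<and> \<Psi> G) \<cong>\<^sub>S graph_species \<Phi>"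
    (is "E\<^sub>S \<circ>\<^sub>S ?C \<cong>\<^sub>S _")
proof (rule species_isoI[where \<eta> = "\<lambda>U (\<pi>, s, g). block_union \<pi> g"])
  show "is_species (E\<^sub>S \<circ>\<^sub>S ?C)" "is_species (graph_species \<Phi>)"
    by (intro is_species_comp is_species_sets is_species_graph_species iso_invariant_conj
        iso_invariant_connected inv)+
next
  fix U :: "'a set" assume U: "finite U"
  show "bij_betw (\<lambda>(\<pi>, s, g). block_union \<pi> g) (structs (E\<^sub>S \<circ>\<^sub>S ?C) U) (structs (graph_species \<Phi>) U)"
  proof (rule bij_betwI[where g = "\<lambda>G. (components G, (), \<lambda>B\<in>components G. induced G B)"])
    have *: "block_union \<pi> g \<in> structs (graph_species \<Phi>) U \<and> components (block_union \<pi> g) = \<pi>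
        \<and> (\<lambda>B\<in>\<pi>. induced (block_union \<pi> g) B) = g"
      if "(\<pi>, s, g) \<in> structs (E\<^sub>S \<circ>\<^sub>S ?C) U" for \<pi> s g
    proof -
      have \<pi>: "partition_on U \<pi>" and ext: "g \<in> extensional \<pi>"
        and g: "\<And>B. B \<in> \<pi> \<Longrightarrow> pair_graph (g B)" "\<And>B. B \<in> \<pi> \<Longrightarrow> pverts (g B) = B"
          "\<And>B. B \<in> \<pi> \<Longrightarrow> connected (with_proj (g B))" "\<And>B. B \<in> \<pi> \<Longrightarrow> \<Psi> (g B)"
        using that by (auto simp: species_comp_def graph_species_def PiE_iff)
      have UU: "\<Union>\<pi> = U"
        using partition_onD1[OF \<pi>] by simp
      have comps: "components (block_union \<pi> g) = \<pi>"
        by (rule components_block_union[OF U \<pi> g(1-3)])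
      have ind: "induced (block_union \<pi> g) B = g B" if "B \<in> \<pi>" for B
        by (rule induced_block_union[OF partition_onD2[OF \<pi>] g(1,2) that])
      have "pair_graph (block_union \<pi> g)"
        using U UU g by (intro pair_graph_block_union) auto
      then have "block_union \<pi> g \<in> structs (graph_species \<Phi>) U"
        using local comps ind g UU by (simp add: graph_species_def)
      moreover have "(\<lambda>B\<in>\<pi>. induced (block_union \<pi> g) B) = g"
        using ind ext by (intro extensionalityI[of _ \<pi>]) auto
      ultimately show ?thesis
        using comps by blast
    qed
    then show "(\<lambda>(\<pi>, s, g). block_union \<pi> g) \<in> structs (E\<^sub>S \<circ>\<^sub>S ?C) U \<rightarrow> structs (graph_species \<Phi>) U"
      by auto
    show "(\<lambda>G. (components G, (), \<lambda>B\<in>components G. induced G B)) ((\<lambda>(\<pi>, s, g). block_union \<pi> g) x) = x"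
      if "x \<in> structs (E\<^sub>S \<circ>\<^sub>S ?C) U" for x
      using that * by (cases x) auto
  next
    have **: "partition_on (pverts G) (components G)" "B \<in> components G \<Longrightarrow> B \<subseteq> pverts G"
      if "pair_graph G" for G :: "'a pair_pre_digraph" and B
      using partition_on_components[OF that] by (auto simp: partition_on_def)
    then show "(\<lambda>G. (components G, (), \<lambda>B\<in>components G. induced G B))
        \<in> structs (graph_species \<Phi>) U \<rightarrow> structs (E\<^sub>S \<circ>\<^sub>S ?C) U"
      using local
      by (auto simp: graph_species_def species_comp_def species_sets_def pair_graph_induced
          connected_component)
    show "(\<lambda>(\<pi>, s, g). block_union \<pi> g) (components G, (), \<lambda>B\<in>components G. induced G B) = G"
      if "G \<in> structs (graph_species \<Phi>) U" for G
    proof -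
      have G: "pair_graph G"
        using that by (simp add: graph_species_def)
      show ?thesis
        using partition_onD1[OF **(1)[OF G]] parcs_components[OF G] by (simp add: block_union_def)
    qed
  qed
next
  fix U :: "'a set" and \<sigma> :: "'a \<Rightarrow> 'a" and x
  assume U: "finite U" "inj_on \<sigma> U" and x: "x \<in> structs (E\<^sub>S \<circ>\<^sub>S ?C) U"
  obtain \<pi> s g where xeq: "x = (\<pi>, s, g)"
    by (cases x)
  have \<pi>: "partition_on U \<pi>"
    using x xeq by (simp add: species_comp_def)
  define h where "h = snd (snd (transport (E\<^sub>S \<circ>\<^sub>S ?C) U \<sigma> x))"
  have "h (\<sigma> ` B) = relabel \<sigma> (g B)" if "B \<in> \<pi>" for B
    using transport_comp_family[OF \<pi> U(2) that, of "E\<^sub>S" ?C s g]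
    unfolding h_def xeq by (simp add: transport_graph_species)
  moreover have "transport (E\<^sub>S \<circ>\<^sub>S ?C) U \<sigma> x = ((`) \<sigma> ` \<pi>, s, h)"
    by (simp add: h_def xeq species_comp_def species_sets_def)
  ultimately show "(\<lambda>(\<pi>, s, g). block_union \<pi> g) (transport (E\<^sub>S \<circ>\<^sub>S ?C) U \<sigma> x)
      = transport (graph_species \<Phi>) U \<sigma> ((\<lambda>(\<pi>, s, g). block_union \<pi> g) x)"
    using relabel_block_union[of \<pi> h \<sigma> g] by (simp add: xeq graph_species_def)
qed

section \<open>Neighborhoods in components\<close>

lemma point_determining_iff: "point_determining G \<longleftrightarrow> inj_on (neighborhood G) (pverts G)"
  by (auto simp: point_determining_def inj_on_def)

text \<open>
  Taking the complement of the graph complements closed neighborhoods in the vertex set.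
\<close>

lemma co_point_determining_iff:
  "co_point_determining G \<longleftrightarrow> inj_on (\<lambda>v. insert v (neighborhood G v)) (pverts G)"
proof -
  have "neighborhood (graph_complement G) v = pverts G - insert v (neighborhood G v)"
    if "v \<in> pverts G" for v
    using that by (auto simp: neighborhood_def graph_complement_def)
  moreover have "insert v (neighborhood G v) \<subseteq> pverts G" if "v \<in> pverts G" for v
    using that neighborhood_subset[of G v] by simp
  ultimately have "neighborhood (graph_complement G) u = neighborhood (graph_complement G) v
      \<longleftrightarrow> insert u (neighborhood G u) = insert v (neighborhood G v)"
    if "u \<in> pverts G" "v \<in> pverts G" for u v
    using that by (metis double_diff subset_refl)
  then show ?thesis
    by (simp add: co_point_determining_def point_determining_iff inj_on_def)
qed

lemma neighborhood_component:
  assumes "pair_graph G" "B \<in> components G" "v \<in> B"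
  shows "neighborhood (induced G B) v = neighborhood G v"
  using component_closed[OF assms(1,2,3)] assms
  by (auto simp: neighborhood_def pair_graph_iff)

text \<open>
  Values at points of different blocks are disjoint and nonempty, hence different. It is applied
  with open and with closed neighborhoods for \<open>f\<close>; nonemptiness is what fails for the open
  neighborhoods of isolated vertices.
\<close>

lemma inj_on_partition_iff:
  assumes \<pi>: "partition_on U \<pi>"
    and sub: "\<And>B v. B \<in> \<pi> \<Longrightarrow> v \<in> B \<Longrightarrow> f v \<subseteq> B \<and> f v \<noteq> {}"
  shows "inj_on f U \<longleftrightarrow> (\<forall>B\<in>\<pi>. inj_on f B)"
proof
  assume "inj_on f U"
  then show "\<forall>B\<in>\<pi>. inj_on f B"
    using partition_onD1[OF \<pi>] by (auto intro: inj_on_subset)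
next
  assume inj: "\<forall>B\<in>\<pi>. inj_on f B"
  show "inj_on f U"
  proof (rule inj_onI)
    fix u v assume uv: "u \<in> U" "v \<in> U" "f u = f v"
    then obtain B C where BC: "B \<in> \<pi>" "u \<in> B" "C \<in> \<pi>" "v \<in> C"
      using partition_onD1[OF \<pi>] by blast
    then have "B \<inter> C \<noteq> {}"
      using sub[of B u] sub[of C v] uv by auto
    then have "B = C"
      using partition_onD2[OF \<pi>] BC disjointD by metis
    then show "u = v"
      using inj BC uv by (auto dest: inj_onD)
  qed
qed

lemma co_point_determining_components:
  assumes G: "pair_graph G"
  shows "co_point_determining G \<longleftrightarrow> (\<forall>B\<in>components G. co_point_determining (induced G B))"
proof -
  have "inj_on (\<lambda>v. insert v (neighborhood G v)) (pverts G)
      \<longleftrightarrow> (\<forall>B\<in>components G. inj_on (\<lambda>v. insert v (neighborhood G v)) B)"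
    using component_closed[OF G]
    by (intro inj_on_partition_iff[OF partition_on_components[OF G]])
      (auto simp: neighborhood_def)
  also have "\<dots> \<longleftrightarrow> (\<forall>B\<in>components G. co_point_determining (induced G B))"
    by (intro ball_cong)
      (simp_all add: co_point_determining_iff inj_on_def neighborhood_component[OF G])
  finally show ?thesis
    by (simp add: co_point_determining_iff)
qed

definition no_isolated :: "'a pair_pre_digraph \<Rightarrow> bool" where
  "no_isolated G \<longleftrightarrow> (\<forall>v\<in>pverts G. neighborhood G v \<noteq> {})"

text \<open>
  In a connected graph the first arc of a path to any other vertex gives a neighbor, so the
  one-vertex graph is the only connected graph with an isolated vertex.
\<close>

lemma connected_no_isolated_iff:
  assumes "pair_graph G" "connected (with_proj G)"
  shows "no_isolated G \<longleftrightarrow> 2 \<le> card (pverts G)"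
proof
  have fin: "finite (pverts G)"
    using assms by (simp add: pair_graph_iff)
  assume iso: "no_isolated G"
  obtain v where v: "v \<in> pverts G"
    using assms by (auto simp: connected_iff)
  then obtain w where "w \<in> pverts G" "(v, w) \<in> parcs G"
    using iso by (auto simp: no_isolated_def neighborhood_def)
  moreover from this have "v \<noteq> w"
    using assms by (auto simp: pair_graph_iff irrefl_def)
  ultimately have "card {v, w} \<le> card (pverts G)"
    using v fin by (intro card_mono) auto
  then show "2 \<le> card (pverts G)"
    using \<open>v \<noteq> w\<close> by simp
next
  assume card: "2 \<le> card (pverts G)"
  have "neighborhood G v \<noteq> {}" if v: "v \<in> pverts G" for v
  proof -
    have "\<not> pverts G \<subseteq> {v}"
      using card card_mono[of "{v}" "pverts G"] by auto
    then obtain w where "w \<in> pverts G" "w \<noteq> v"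
      by blast
    then have "(v, w) \<in> (parcs G)\<^sup>*"
      using assms v by (simp add: connected_iff)
    then obtain u where "(v, u) \<in> parcs G"
      using \<open>w \<noteq> v\<close> by (auto elim: converse_rtranclE)
    then show ?thesis
      using assms by (auto simp: neighborhood_def pair_graph_iff)
  qed
  then show "no_isolated G"
    by (simp add: no_isolated_def)
qed

text \<open>
  The two conditions cannot be treated independently: being point-determining is tested on
  components only once there are no isolated vertices.
\<close>

lemma point_determining_no_isolated_components:
  assumes G: "pair_graph G"
  shows "point_determining G \<and> no_isolated G \<longleftrightarrow>
    (\<forall>B\<in>components G. point_determining (induced G B) \<and> 2 \<le> card (pverts (induced G B)))"
proof -
  note part = partition_on_components[OF G]
  have sub: "B \<subseteq> pverts G" if "B \<in> components G" for B
    using part that by (auto simp: partition_on_def)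
  have "no_isolated G \<longleftrightarrow> (\<forall>B\<in>components G. no_isolated (induced G B))"
    using partition_onD1[OF part] neighborhood_component[OF G]
    by (simp add: no_isolated_def)
  also have "\<dots> \<longleftrightarrow> (\<forall>B\<in>components G. 2 \<le> card (pverts (induced G B)))"
    using connected_no_isolated_iff[OF pair_graph_induced[OF G sub] connected_component[OF G]]
    by simp
  finally have card: "no_isolated G \<longleftrightarrow> (\<forall>B\<in>components G. 2 \<le> card (pverts (induced G B)))" .
  have "point_determining G \<longleftrightarrow> (\<forall>B\<in>components G. point_determining (induced G B))"
    if "no_isolated G"
  proof -
    have "inj_on (neighborhood G) (pverts G)
        \<longleftrightarrow> (\<forall>B\<in>components G. inj_on (neighborhood G) B)"
    proof (rule inj_on_partition_iff[OF part], rule conjI)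
      fix B v assume B: "B \<in> components G" "v \<in> B"
      show "neighborhood G v \<subseteq> B"
        using component_closed[OF G B] by (auto simp: neighborhood_def)
      show "neighborhood G v \<noteq> {}"
        using that sub B by (auto simp: no_isolated_def)
    qed
    also have "\<dots> \<longleftrightarrow> (\<forall>B\<in>components G. point_determining (induced G B))"
      by (intro ball_cong)
        (simp_all add: point_determining_iff inj_on_def neighborhood_component[OF G])
    finally show ?thesis
      by (simp add: point_determining_iff)
  qed
  with card show ?thesis
    by blast
qed

lemma iso_invariant_no_isolated: "iso_invariant no_isolated"
  by (auto simp: iso_invariant_def no_isolated_def neighborhood_relabel)

lemma iso_invariant_card: "iso_invariant (\<lambda>G. P (card (pverts G)))"
  by (auto simp: iso_invariant_def card_image)

section \<open>Splitting off the isolated vertex\<close>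

lemma structs_one_plus_X:
  "structs (1\<^sub>S +\<^sub>S X\<^sub>S) A = (if A = {} then {Inl ()} else if card A = 1 then {Inr ()} else {})"
  by (auto simp: species_sum_def species_one_def species_X_def)

lemma transport_one_plus_X: "transport (1\<^sub>S +\<^sub>S X\<^sub>S) A \<sigma> s = s"
  by (cases s) (auto simp: species_sum_def species_one_def species_X_def)

text \<open>
  The first factor of the product carries the set of isolated vertices, which has at most one
  element because such vertices share the empty neighborhood; the map adds it to the graph of the
  second factor without adding arcs. The set is recovered as the isolated vertices of the result
  because the second factor has none of its own.
\<close>

lemma point_determining_split_isolated:
  "(1\<^sub>S +\<^sub>S X\<^sub>S) \<cdot>\<^sub>S graph_species (\<lambda>G. point_determining G \<and> no_isolated G) \<cong>\<^sub>S \<P>"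
    (is "_ \<cdot>\<^sub>S ?N \<cong>\<^sub>S _")
proof (rule species_isoI[where \<eta> = "\<lambda>U (A, B, s, G). \<lparr>pverts = U, parcs = parcs G\<rparr>"])
  show "is_species ((1\<^sub>S +\<^sub>S X\<^sub>S) \<cdot>\<^sub>S ?N)" "is_species \<P>"
    unfolding \<P>_def
    by (intro is_species_prod is_species_sum is_species_one is_species_X
        is_species_graph_species iso_invariant_conj iso_invariant_point_determining
        iso_invariant_no_isolated)+
next
  fix U :: "'a set" assume U: "finite U"
  define iso where "iso G = {v \<in> pverts G. neighborhood G v = {}}" for G :: "'a pair_pre_digraph"
  define inverse where "inverse G = (iso G, pverts G - iso G,
      if iso G = {} then Inl () else Inr (), \<lparr>pverts = pverts G - iso G, parcs = parcs G\<rparr>)"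
    for G :: "'a pair_pre_digraph"
  let ?\<eta> = "\<lambda>(A :: 'a set, B :: 'a set, s :: unit + unit, G). \<lparr>pverts = U, parcs = parcs G\<rparr>"
  have *: "?\<eta> x \<in> structs \<P> U \<and> inverse (?\<eta> x) = x"
    if x: "x \<in> structs ((1\<^sub>S +\<^sub>S X\<^sub>S) \<cdot>\<^sub>S ?N) U" for x
  proof -
    obtain A B s G where xeq: "x = (A, B, s, G)"
      by (cases x)
    have AB: "A \<union> B = U" "A \<inter> B = {}" and s: "s \<in> structs (1\<^sub>S +\<^sub>S X\<^sub>S) A"
      and G: "pair_graph G" "pverts G = B" "point_determining G" "no_isolated G"
      using x by (auto simp: xeq species_prod_def graph_species_def)
    let ?H = "\<lparr>pverts = U, parcs = parcs G\<rparr>"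
    have H: "pair_graph ?H"
      using G AB U by (auto simp: pair_graph_iff)
    have nB: "neighborhood ?H v = neighborhood G v" for v
      using G AB by (auto simp: neighborhood_def pair_graph_iff)
    have nA: "neighborhood ?H v = {}" if "v \<in> A" for v
      using that G AB by (auto simp: neighborhood_def pair_graph_iff)
    have iso: "iso ?H = A"
      using nA nB G(2,4) AB by (auto simp: iso_def no_isolated_def)
    have "u = v" if "u \<in> A" "v \<in> A" for u v
      using that s by (auto simp: structs_one_plus_X card_1_singleton_iff split: if_splits)
    then have "inj_on (neighborhood ?H) U"
      using G(2,3,4) AB nA nB
      unfolding point_determining_iff no_isolated_def inj_on_def by (metis Un_iff)
    then have "?H \<in> structs \<P> U"
      using H by (simp add: \<P>_def graph_species_def point_determining_iff)
    moreover have "inverse ?H = x"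
    proof -
      have "\<lparr>pverts = U - A, parcs = parcs G\<rparr> = G"
        using AB G(2) by (cases G) auto
      then show ?thesis
        using iso AB G(2) s
        by (auto simp: inverse_def xeq structs_one_plus_X split: if_splits)
    qed
    ultimately show ?thesis
      by (simp add: xeq)
  qed
  have **: "inverse G \<in> structs ((1\<^sub>S +\<^sub>S X\<^sub>S) \<cdot>\<^sub>S ?N) U \<and> ?\<eta> (inverse G) = G"
    if "G \<in> structs \<P> U" for G
  proof -
    have G: "pair_graph G" "pverts G = U" "inj_on (neighborhood G) U"
      using that by (auto simp: \<P>_def graph_species_def point_determining_iff)
    let ?H = "\<lparr>pverts = pverts G - iso G, parcs = parcs G\<rparr>"
    have "x \<notin> iso G" "y \<notin> iso G" if "(x, y) \<in> parcs G" for x y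
      using that G(1) by (auto simp: iso_def neighborhood_def pair_graph_iff dest: symD)
    note arcs = this
    have H: "pair_graph ?H"
      using G(1) arcs by (auto simp: pair_graph_iff)
    have n: "neighborhood ?H v = neighborhood G v" for v
      using arcs by (auto simp: neighborhood_def)
    have "point_determining ?H \<and> no_isolated ?H"
      using G(2,3) n
      by (auto simp: point_determining_iff no_isolated_def iso_def cong: inj_on_cong
          intro: inj_on_subset)
    moreover have "iso G = {} \<or> card (iso G) = 1"
    proof (cases "iso G = {}")
      case False
      then obtain v where "v \<in> iso G"
        by blast
      then have "iso G = {v}"
        using G(2,3) by (auto simp: iso_def inj_on_def)
      then show ?thesis
        by simp
    qed simp
    moreover have "iso G \<subseteq> U"
      using G(2) by (auto simp: iso_def)
    ultimately show ?thesis
      using H G(2) by (auto simp: inverse_def species_prod_def structs_one_plus_X graph_species_def)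
  qed
  show "bij_betw ?\<eta> (structs ((1\<^sub>S +\<^sub>S X\<^sub>S) \<cdot>\<^sub>S ?N) U) (structs \<P> U)"
    by (rule bij_betwI[where g = inverse]) (use * ** in blast)+
next
  fix U :: "'a set" and \<sigma> :: "'a \<Rightarrow> 'a" and x
  show "(\<lambda>(A, B, s, G). \<lparr>pverts = \<sigma> ` U, parcs = parcs G\<rparr>) (transport ((1\<^sub>S +\<^sub>S X\<^sub>S) \<cdot>\<^sub>S ?N) U \<sigma> x)
      = transport \<P> U \<sigma> ((\<lambda>(A, B, s, G). \<lparr>pverts = U, parcs = parcs G\<rparr>) x)"
    by (cases x) (simp add: species_prod_def \<P>_def graph_species_def relabel_def)
qed

section \<open>The decomposition theorem\<close>

lemma species_ge_connected_point_determining: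
  "species_ge 2 \<P>\<^sub>c = graph_species (\<lambda>G. connected (with_proj G) \<and>
    (point_determining G \<and> 2 \<le> card (pverts G)))"
  by (auto simp: species_ge_def \<P>\<^sub>c_def graph_species_def fun_eq_iff)

theorem theorem2p3:
  shows "(\<P> :: ('a, 'a pair_pre_digraph) species) \<cong>\<^sub>S \<Q>
    \<and> (\<Q> :: ('a, 'a pair_pre_digraph) species) \<cong>\<^sub>S (1\<^sub>S +\<^sub>S X\<^sub>S) \<cdot>\<^sub>S (E\<^sub>S \<circ>\<^sub>S species_ge 2 \<P>\<^sub>c)
    \<and> (1\<^sub>S +\<^sub>S X\<^sub>S) \<cdot>\<^sub>S (E\<^sub>S \<circ>\<^sub>S species_ge 2 (\<P>\<^sub>c :: ('a, 'a pair_pre_digraph) species))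
        \<cong>\<^sub>S E\<^sub>S \<circ>\<^sub>S \<Q>\<^sub>c"
proof -
  let ?N = "graph_species (\<lambda>G :: 'a pair_pre_digraph. point_determining G \<and> no_isolated G)"
  let ?R = "(1\<^sub>S +\<^sub>S X\<^sub>S) \<cdot>\<^sub>S (E\<^sub>S \<circ>\<^sub>S species_ge 2 (\<P>\<^sub>c :: ('a, 'a pair_pre_digraph) species))"
  have "E\<^sub>S \<circ>\<^sub>S species_ge 2 \<P>\<^sub>c \<cong>\<^sub>S ?N"
    unfolding species_ge_connected_point_determining
    by (intro sets_of_connected_graphs iso_invariant_conj iso_invariant_point_determining
        iso_invariant_no_isolated iso_invariant_card point_determining_no_isolated_components)
  then have "?R \<cong>\<^sub>S (1\<^sub>S +\<^sub>S X\<^sub>S) \<cdot>\<^sub>S ?N"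
    by (intro species_prod_cong_right is_species_sum is_species_one is_species_X)
  also have "\<dots> \<cong>\<^sub>S \<P>"
    by (rule point_determining_split_isolated)
  finally have RP: "?R \<cong>\<^sub>S \<P>" .
  also have PQ: "\<P> \<cong>\<^sub>S \<Q>"
    by (rule point_determining_iso_co_point_determining)
  finally have RQ: "?R \<cong>\<^sub>S \<Q>" .
  have QC: "E\<^sub>S \<circ>\<^sub>S \<Q>\<^sub>c \<cong>\<^sub>S (\<Q> :: ('a, 'a pair_pre_digraph) species)"
    unfolding \<Q>_def \<Q>\<^sub>c_def
    by (intro sets_of_connected_graphs iso_invariant_co_point_determining
        co_point_determining_components)
  show ?thesis
    using PQ species_iso_sym[OF RQ] species_iso_trans[OF RQ species_iso_sym[OF QC]] by blast
qed

end
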